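(* Let $\theta\in\mathbb{C}$ and let $q$ be a (not identically zero) meromorphic solution, on a connected open set $U\subset\mathbb{C}^*$, of the equation ${\rm PIII(D_7)}$ with parameter $\theta$: $$q''=\frac{(q')^2}{q}-\frac{q'}{t}-\frac{\theta}{t}+\frac{2q^2}{t^2}-\frac1q.$$ Put $a=\frac{tq'-q}{2}$. Then $$\tilde q=\frac{t(\theta q-2a+t)}{2q^2}$$ is a solution of ${\rm PIII(D_7)}$ with parameter $1+\theta$, i.e. $$\tilde q''=\frac{(\tilde q')^2}{\tilde q}-\frac{\tilde q'}{t}-\frac{1+\theta}{t}+\frac{2\tilde q^2}{t^2}-\frac1{\tilde q}.$$
   Context: Here $'=\frac{d}{dt}$, and solutions are understood as meromorphic functions satisfying the equation as an identity of meromorphic functions. *)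

theory Defs
  imports "HOL-Complex_Analysis.Complex_Analysis"
begin

text \<open>
  A function that is \<open>meromorphic_on U\<close> may take arbitrary values on a sparse subset of \<open>U\<close>
  (in particular at its poles).  Equality of such functions as meromorphic functions is therefore
  equality at all points of \<open>U\<close> outside a sparse set, i.e. eventually w.r.t. \<open>cosparse U\<close>.

  A solution is required not to be the zero meromorphic function, since the equation
  divides by \<open>q\<close>.
\<close>

definition PIII_D7_solution :: "complex \<Rightarrow> complex set \<Rightarrow> (complex \<Rightarrow> complex) \<Rightarrow> bool" where
  "PIII_D7_solution \<theta> U q \<longleftrightarrow>
     q meromorphic_on U \<and>
     \<not> (\<forall>\<^sub>F t in cosparse U. q t = 0) \<and>
     (\<forall>\<^sub>F t in cosparse U.
        deriv (deriv q) t =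
          (deriv q t)\<^sup>2 / q t - deriv q t / t - \<theta> / t + 2 * (q t)\<^sup>2 / t\<^sup>2 - 1 / q t)"

end

(*
  Put N = (1 + \<theta>) q + t (1 - q'), so that qt = t N / (2 q^2).  The equation for q gives
  N' = N (q' + 1) / q - 2 q^2 / t, so N cannot vanish identically, since q does not.  Hence qt
  satisfies the Riccati equation qt' = qt / t + qt (1 - q') / q - 1.  Differentiating it and
  eliminating q'' leaves the identity (qt + q) ((1 + \<theta>) / (t q) + (1 - q') / q^2 - 2 qt / t^2) = 0,
  whose second factor vanishes by definition of qt.
*)
theory Submission
  imports Defs
begin

text \<open>Removing a single point from an open set leaves an open set, so a property valid on a
  punctured neighbourhood of \<open>x\<close> is valid near each of its points. This upgrade allows
  identities that hold off a sparse set to be differentiated.\<close>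

lemma eventually_cosparse_nhds:
  fixes P :: "'a :: t1_space \<Rightarrow> bool"
  assumes "open U" "\<forall>\<^sub>F t in cosparse U. P t"
  shows "\<forall>\<^sub>F t in cosparse U. \<forall>\<^sub>F s in nhds t. P s"
proof -
  have "\<forall>\<^sub>F t in at x. \<forall>\<^sub>F s in nhds t. P s" if "x \<in> U" for x
  proof -
    have "\<forall>\<^sub>F t in at x. P t"
      using assms that by (auto simp: eventually_cosparse_open_eq)
    then obtain S where "open S" "x \<in> S" "\<forall>t\<in>S. t \<noteq> x \<longrightarrow> P t"
      by (auto simp: eventually_at_topological)
    then have "\<forall>\<^sub>F s in nhds t. P s" if "t \<in> S - {x}" for t
      using that by (intro eventually_nhds_in_open[THEN eventually_mono, of "S - {x}"])
        (auto simp: open_delete)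
    with \<open>open S\<close> \<open>x \<in> S\<close> show ?thesis
      by (auto simp: eventually_at_topological)
  qed
  with assms(1) show ?thesis
    by (simp add: eventually_cosparse_open_eq)
qed

text \<open>This is the identity theorem for meromorphic functions, and the place where
  connectedness of \<open>U\<close> enters.\<close>

lemma meromorphic_eventually_nonzero_cosparse:
  assumes "f meromorphic_on U" "open U" "connected U" "\<not> (\<forall>\<^sub>F t in cosparse U. f t = 0)"
  shows "\<forall>\<^sub>F t in cosparse U. f t \<noteq> 0"
  using meromorphic_imp_constant_or_avoid[OF assms(1-3), of 0] assms(4) by blast

text \<open>Once q'' is eliminated, the derivative is (1 + \<theta>) (q' + 1) + t (1 - q'^2) / q - 2
  q^2 / t. The first two terms share the factor q' + 1, whose cofactor is the numerator divided by
  q.\<close>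

lemma PIII_D7_numerator_has_derivative:
  assumes "(q has_field_derivative deriv q t) (at t)"
    and "(deriv q has_field_derivative deriv (deriv q) t) (at t)"
    and "t \<noteq> 0" "q t \<noteq> 0"
    and "deriv (deriv q) t =
          (deriv q t)\<^sup>2 / q t - deriv q t / t - \<theta> / t + 2 * (q t)\<^sup>2 / t\<^sup>2 - 1 / q t"
  shows "((\<lambda>s. (1 + \<theta>) * q s + s * (1 - deriv q s)) has_field_derivative
          ((1 + \<theta>) * q t + t * (1 - deriv q t)) * (deriv q t + 1) / q t - 2 * (q t)\<^sup>2 / t) (at t)"
proof -
  have "((\<lambda>s. (1 + \<theta>) * q s + s * (1 - deriv q s)) has_field_derivative
         (1 + \<theta>) * deriv q t + (1 - deriv q t) - t * deriv (deriv q) t) (at t)"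
    by (rule derivative_eq_intros assms refl | simp)+
  also have "(1 + \<theta>) * deriv q t + (1 - deriv q t) - t * deriv (deriv q) t =
      ((1 + \<theta>) * q t + t * (1 - deriv q t)) * (deriv q t + 1) / q t - 2 * (q t)\<^sup>2 / t"
    unfolding assms(5) using assms(3,4) by (simp add: field_simps power2_eq_square)
  finally show ?thesis .
qed

text \<open>In the derivative of t N / (2 q^2), the denominator contributes -2 qt q' / q, which
  turns the factor q' + 1 from N' into 1 - q', and the term -2 q^2 / t of N' becomes the constant
  -1. Nothing is divided by \<open>qt\<close>, so the equation also holds at zeros of
  \<open>qt\<close>.\<close>

lemma PIII_D7_transform_riccati:
  assumes "(q has_field_derivative deriv q t) (at t)"
    and "(deriv q has_field_derivative deriv (deriv q) t) (at t)"
    and "t \<noteq> 0" "q t \<noteq> 0"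
    and "deriv (deriv q) t =
          (deriv q t)\<^sup>2 / q t - deriv q t / t - \<theta> / t + 2 * (q t)\<^sup>2 / t\<^sup>2 - 1 / q t"
    and qt: "qt = (\<lambda>s. s * ((1 + \<theta>) * q s + s * (1 - deriv q s)) / (2 * (q s)\<^sup>2))"
  shows "(qt has_field_derivative qt t / t + qt t * (1 - deriv q t) / q t - 1) (at t)"
proof -
  define N where "N = (\<lambda>s. (1 + \<theta>) * q s + s * (1 - deriv q s))"
  have N: "(N has_field_derivative N t * (deriv q t + 1) / q t - 2 * (q t)\<^sup>2 / t) (at t)"
    unfolding N_def by (rule PIII_D7_numerator_has_derivative[OF assms(1-5)])
  have qt': "qt = (\<lambda>s. s * N s / (2 * (q s)\<^sup>2))"
    by (simp add: qt N_def)
  show ?thesis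
    unfolding qt'
    by (rule derivative_eq_intros assms(1) N refl | simp add: assms(4))+
      (use assms(3,4) in \<open>simp add: field_simps eval_nat_numeral\<close>)
qed

text \<open>The Riccati equation is differentiated once more, so it has to hold on a neighbourhood
  of \<open>t\<close> and not only at \<open>t\<close>.\<close>

lemma PIII_D7_transform_on_open:
  assumes "open S" "q holomorphic_on S" "t \<in> S"
    and nz: "\<And>s. s \<in> S \<Longrightarrow> s \<noteq> 0 \<and> q s \<noteq> 0"
    and ode: "\<And>s. s \<in> S \<Longrightarrow> deriv (deriv q) s =
          (deriv q s)\<^sup>2 / q s - deriv q s / s - \<theta> / s + 2 * (q s)\<^sup>2 / s\<^sup>2 - 1 / q s"
    and qt: "qt = (\<lambda>s. s * ((1 + \<theta>) * q s + s * (1 - deriv q s)) / (2 * (q s)\<^sup>2))"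
    and "qt t \<noteq> 0"
  shows "deriv (deriv qt) t =
          (deriv qt t)\<^sup>2 / qt t - deriv qt t / t - (1 + \<theta>) / t + 2 * (qt t)\<^sup>2 / t\<^sup>2 - 1 / qt t"
proof -
  have q1: "(q has_field_derivative deriv q s) (at s)" if "s \<in> S" for s
    using assms(2,1) that by (rule holomorphic_derivI)
  have q2: "(deriv q has_field_derivative deriv (deriv q) s) (at s)" if "s \<in> S" for s
    using holomorphic_deriv[OF assms(2,1)] assms(1) that by (intro holomorphic_derivI)
  have R: "(qt has_field_derivative qt s / s + qt s * (1 - deriv q s) / q s - 1) (at s)"
    if "s \<in> S" for s
    using PIII_D7_transform_riccati[OF q1 q2 _ _ ode qt] nz that by blast
  \<comment> \<open>Naming the values at \<open>t\<close> reduces the claim to an identity between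
    rational expressions.\<close>
  define Q p r R R' where "Q = q t" and "p = deriv q t" and "r = deriv (deriv q) t"
    and "R = qt t" and "R' = R / t + R * (1 - p) / Q - 1"
  have nz_t: "t \<noteq> 0" "Q \<noteq> 0" "R \<noteq> 0"
    using nz[OF \<open>t \<in> S\<close>] \<open>qt t \<noteq> 0\<close> by (auto simp: Q_def R_def)
  have d1: "deriv qt t = R'"
    using R[OF \<open>t \<in> S\<close>] by (simp add: DERIV_imp_deriv R'_def R_def p_def Q_def)
  have "\<forall>\<^sub>F s in nhds t. deriv qt s = qt s / s + qt s * (1 - deriv q s) / q s - 1"
    using eventually_nhds_in_open[OF \<open>open S\<close> \<open>t \<in> S\<close>]
    by eventually_elim (use R in \<open>auto intro: DERIV_imp_deriv\<close>)
  then have "deriv (deriv qt) t = deriv (\<lambda>s. qt s / s + qt s * (1 - deriv q s) / q s - 1) t"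
    by (intro deriv_cong_ev) auto
  also have "((\<lambda>s. qt s / s + qt s * (1 - deriv q s) / q s - 1) has_field_derivative
      R' / t - R / t\<^sup>2 + R' * (1 - p) / Q - R * r / Q - R * (1 - p) * p / Q\<^sup>2) (at t)"
    using nz_t \<open>t \<in> S\<close>
    by (auto intro!: derivative_eq_intros R[THEN DERIV_cong] q1 q2
        simp: Q_def[symmetric] p_def[symmetric] r_def[symmetric] R_def[symmetric] R'_def[symmetric])
      (simp add: field_simps power2_eq_square)
  then have "deriv (\<lambda>s. qt s / s + qt s * (1 - deriv q s) / q s - 1) t =
      R' / t - R / t\<^sup>2 + R' * (1 - p) / Q - R * r / Q - R * (1 - p) * p / Q\<^sup>2"
    by (rule DERIV_imp_deriv)
  also have "\<dots> = R'\<^sup>2 / R - R' / t - (1 + \<theta>) / t + 2 * R\<^sup>2 / t\<^sup>2 - 1 / R"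
  proof -
    have r: "r = p\<^sup>2 / Q - p / t - \<theta> / t + 2 * Q\<^sup>2 / t\<^sup>2 - 1 / Q"
      using ode[OF \<open>t \<in> S\<close>] by (simp add: r_def p_def Q_def)
    have "R = t * ((1 + \<theta>) * Q + t * (1 - p)) / (2 * Q\<^sup>2)"
      by (simp add: R_def qt p_def Q_def)
    \<comment> \<open>This is the definition of \<open>qt\<close> at \<open>t\<close>, multiplied by
      2 / t^2.\<close>
    then have "(1 + \<theta>) / (t * Q) + (1 - p) / Q\<^sup>2 - 2 * R / t\<^sup>2 = 0"
      using nz_t(1,2) by (simp add: divide_simps power2_eq_square) (simp add: algebra_simps)
    \<comment> \<open>Here \<open>R\<close> is treated as independent of \<open>Q\<close> and
      \<open>p\<close>: only the formulas for \<open>R'\<close> and \<open>r\<close> are inserted.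
      The definition of \<open>qt\<close> enters through the vanishing of the second factor.\<close>
    moreover have "R' / t - R / t\<^sup>2 + R' * (1 - p) / Q - R * r / Q - R * (1 - p) * p / Q\<^sup>2 -
        (R'\<^sup>2 / R - R' / t - (1 + \<theta>) / t + 2 * R\<^sup>2 / t\<^sup>2 - 1 / R) =
        (R + Q) * ((1 + \<theta>) / (t * Q) + (1 - p) / Q\<^sup>2 - 2 * R / t\<^sup>2)"
      unfolding R'_def r using nz_t by (simp add: field_simps power2_eq_square)
    ultimately show ?thesis
      by (metis eq_iff_diff_eq_0 mult_zero_right)
  qed
  finally show ?thesis
    by (simp add: d1 R_def)
qed

theorem mainTheorem6:
  fixes \<theta> :: complex and U :: "complex set" and q a qt :: "complex \<Rightarrow> complex"
  assumes "open U" and "connected U" and "U \<subseteq> - {0}"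
    and "PIII_D7_solution \<theta> U q"
    and "a = (\<lambda>t. (t * deriv q t - q t) / 2)"
    and "qt = (\<lambda>t. t * (\<theta> * q t - 2 * a t + t) / (2 * (q t)\<^sup>2))"
  shows "PIII_D7_solution (1 + \<theta>) U qt"
proof -
  define N where "N = (\<lambda>s. (1 + \<theta>) * q s + s * (1 - deriv q s))"
  have qt: "qt = (\<lambda>s. s * ((1 + \<theta>) * q s + s * (1 - deriv q s)) / (2 * (q s)\<^sup>2))"
  proof
    fix s
    have "\<theta> * q s - 2 * a s + s = (1 + \<theta>) * q s + s * (1 - deriv q s)"
      by (simp add: assms(5) field_simps)
    then show "qt s = s * ((1 + \<theta>) * q s + s * (1 - deriv q s)) / (2 * (q s)\<^sup>2)"
      by (simp add: assms(6))
  qed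
  from assms(4) have q: "q meromorphic_on U" and q_nz: "\<not> (\<forall>\<^sub>F t in cosparse U. q t = 0)"
    and ode: "\<forall>\<^sub>F t in cosparse U. deriv (deriv q) t =
          (deriv q t)\<^sup>2 / q t - deriv q t / t - \<theta> / t + 2 * (q t)\<^sup>2 / t\<^sup>2 - 1 / q t"
    by (auto simp: PIII_D7_solution_def)
  \<comment> \<open>With respect to \<open>bot\<close> every property holds eventually, including
    \<open>q t = 0\<close>. Properness of the filter turns an eventual \<open>False\<close> into a
    contradiction.\<close>
  have nontrivial: "cosparse U \<noteq> bot"
    using q_nz by auto
  have t_nz: "\<forall>\<^sub>F t in cosparse U. t \<noteq> 0"
    using assms(3) by (intro eventually_in_cosparse[THEN eventually_mono, of U U]) (use assms(1) in auto)
  \<comment> \<open>Around a generic point all requirements hold on a full neighbourhood, as the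
    second differentiation demands.\<close>
  have good: "\<forall>\<^sub>F t in cosparse U. \<forall>\<^sub>F s in nhds t. q analytic_on {s} \<and> s \<noteq> 0 \<and> q s \<noteq> 0 \<and>
      deriv (deriv q) s =
        (deriv q s)\<^sup>2 / q s - deriv q s / s - \<theta> / s + 2 * (q s)\<^sup>2 / s\<^sup>2 - 1 / q s"
    using meromorphic_eventually_nonzero_cosparse[OF q assms(1,2) q_nz] t_nz ode
      meromorphic_on_imp_analytic_cosparse[OF q]
    by (intro eventually_cosparse_nhds[OF assms(1)] eventually_conj)
  have N_mero: "N meromorphic_on U"
    unfolding N_def by (intro meromorphic_intros q)
  have "\<not> (\<forall>\<^sub>F t in cosparse U. N t = 0)"
  proof
    assume "\<forall>\<^sub>F t in cosparse U. N t = 0"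
    then have "\<forall>\<^sub>F t in cosparse U. \<forall>\<^sub>F s in nhds t. N s = 0"
      by (rule eventually_cosparse_nhds[OF assms(1)])
    with good have "\<forall>\<^sub>F t in cosparse U. False"
    proof eventually_elim
      case (elim t)
      from elim(1) have t: "q analytic_on {t}" "t \<noteq> 0" "q t \<noteq> 0"
        and ode_t: "deriv (deriv q) t =
          (deriv q t)\<^sup>2 / q t - deriv q t / t - \<theta> / t + 2 * (q t)\<^sup>2 / t\<^sup>2 - 1 / q t"
        by (auto dest: eventually_nhds_x_imp_x)
      have "N t = 0"
        using elim(2) by (rule eventually_nhds_x_imp_x)
      have "(q has_field_derivative deriv q t) (at t)"
        "(deriv q has_field_derivative deriv (deriv q) t) (at t)"
        using t(1) analytic_deriv[OF t(1)]
        by (auto intro: analytic_on_imp_differentiable_at simp: DERIV_deriv_iff_field_differentiable)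
      from PIII_D7_numerator_has_derivative[OF this t(2,3) ode_t]
      have "deriv N t = N t * (deriv q t + 1) / q t - 2 * (q t)\<^sup>2 / t"
        unfolding N_def by (rule DERIV_imp_deriv)
      \<comment> \<open>Since \<open>N\<close> vanishes near \<open>t\<close>, its derivative
        vanishes there too, and the formula for N' leaves 2 q^2 / t = 0, which is
        impossible.\<close>
      moreover have "deriv N t = deriv (\<lambda>_. 0) t"
        using elim(2) by (intro deriv_cong_ev) auto
      ultimately show False
        using \<open>N t = 0\<close> t by simp
    qed
    with nontrivial show False
      by simp
  qed
  from meromorphic_eventually_nonzero_cosparse[OF N_mero assms(1,2) this]
  have N_nz: "\<forall>\<^sub>F t in cosparse U. N t \<noteq> 0" .
  have qt_nz: "\<forall>\<^sub>F t in cosparse U. qt t \<noteq> 0"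
    using meromorphic_eventually_nonzero_cosparse[OF q assms(1,2) q_nz] t_nz N_nz
    by eventually_elim (simp add: qt N_def)
  have "\<not> (\<forall>\<^sub>F t in cosparse U. qt t = 0)"
  proof
    assume "\<forall>\<^sub>F t in cosparse U. qt t = 0"
    with qt_nz have "\<forall>\<^sub>F t in cosparse U. False"
      by eventually_elim simp
    with nontrivial show False
      by simp
  qed
  moreover have "qt meromorphic_on U"
    unfolding qt by (intro meromorphic_intros q)
  moreover have "\<forall>\<^sub>F t in cosparse U. deriv (deriv qt) t =
      (deriv qt t)\<^sup>2 / qt t - deriv qt t / t - (1 + \<theta>) / t + 2 * (qt t)\<^sup>2 / t\<^sup>2 - 1 / qt t"
    using good qt_nz
  proof eventually_elim
    case (elim t)
    \<comment> \<open>The local lemma applies on a neighbourhood \<open>S\<close> of the generic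
      point \<open>t\<close>; \<open>qt\<close> has to be nonzero only at \<open>t\<close>
      itself.\<close>
    from elim(1) obtain S where S: "open S" "t \<in> S"
      "\<And>s. s \<in> S \<Longrightarrow> q analytic_on {s} \<and> s \<noteq> 0 \<and> q s \<noteq> 0 \<and> deriv (deriv q) s =
        (deriv q s)\<^sup>2 / q s - deriv q s / s - \<theta> / s + 2 * (q s)\<^sup>2 / s\<^sup>2 - 1 / q s"
      unfolding eventually_nhds by blast
    have "q holomorphic_on S"
      using S(3) by (meson analytic_imp_holomorphic analytic_on_analytic_at)
    then show ?case
      by (rule PIII_D7_transform_on_open[OF S(1) _ S(2) _ _ qt elim(2)]) (use S(3) in blast)+
  qed
  ultimately show ?thesis
    by (simp add: PIII_D7_solution_def)
qed

end
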